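(* Let $\Omega=\mathbb{R}^d$ with Borel $\sigma$-algebra and Lebesgue measure $m$. Let $\mathcal{F}$ be a convex set with $\mathcal{F}_0\subset\mathcal{F}\subset L_0^+$, and let $S$ be a composite score on $\mathcal{F}$ of the form $S(f,g)=\psi(\langle fU(g)\rangle,\langle V(g)\rangle)$ for all $f,g\in\mathcal{F}$, where $U,V,\psi$ satisfy conditions (a), (b), (c) of the context. Suppose that the divergence associated with $S$ is affine invariant. Then, each up to a constant factor, the functions $U$ and $V$ are given on $z>0$ either by $U(z)=z^\gamma+c$ and $V(z)=z^{1+\gamma}$ for some $\gamma>0$ and some constant $c\in\mathbb{R}$, or by $U(z)=-\log z+c$ and $V(z)=z$ for some constant $c\in\mathbb{R}$.
   Context: Notation: $\mathbb{R}_+=[0,\infty)$, $\mathbb{R}_+^\circ=(0,\infty)$; $\langle f\rangle=\int_\Omega f\,dm$; $L_0^+$ is the set of non-negative, non-zero measurable functions $\Omega\to\mathbb{R}$; $\mathcal{P}=\{p\in\mathcal{F}:\langle p\rangle=1\}$; $\psi_1,\psi_2$ are the partial derivatives of $\psi$ in its first and second arguments. $\mathcal{F}_0$ is the set of $f\in L_0^+$ such that $\{\omega\in\Omega: f(\omega)>0\}=(0,1)^d$ and there exist $a,b\in\mathbb{R}$ with $0<a<f(\omega)<b$ for all $\omega\in(0,1)^d$. Composite score on a convex set $\mathcal{F}\subset L_0^+$: a function $S:\mathcal{F}\times\mathcal{F}\to\mathbb{R}$ such that (i) $S(f,g)=T(\int_\Omega S_0(\omega,g)f(\omega)dm(\omega),g)$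 for some $S_0:\Omega\times\mathcal{F}\to\mathbb{R}$, $T:\mathbb{R}\times\mathcal{F}\to\mathbb{R}$, with $S_0(\cdot,g)f(\cdot)$ integrable for all $f,g\in\mathcal{F}$; (ii) $S(f,g)\ge S(f,f)$ for all $f,g\in\mathcal{F}$; (iii) for $p,q\in\mathcal{P}$, $S(p,q)=S(p,p)$ implies $p=q$ almost everywhere. The associated divergence is $D(f,g)=S(f,g)-S(f,f)$. Affine invariance: for an invertible matrix $\sigma\in\mathbb{R}^{d\times d}$ and $\mu\in\mathbb{R}^d$, put $p_{\sigma,\mu}(\omega)=|\det\sigma|\,p(\sigma\omega+\mu)$. $D$ is affine invariant if there is a function $h(\sigma,\mu)$ with values in $\mathbb{R}_+^\circ$ such that $h(\sigma,\mu)D(p_{\sigma,\mu},q_{\sigma,\mu})=D(p,q)$ for all $p,q\in\mathcal{P}$ and all such $(\sigma,\mu)$; here $D(p_{\sigma,\mu},q_{\sigma,\mu})$ is required to be well defined, by the formula defining $S$. Conditions on $U,V,\psi$: (a) $U,V:\mathbb{R}_+\to\mathbb{R}$, $\psi$ is a real-valued function on a subset of $\mathbb{R}^2$, and $fU(g)$ and $V(g)$ are integrable for all $f,g\in\mathcal{F}$. (b) $U$ and $V$ are twice continuously differentiable on $\mathbb{R}_+^\circ$ and are not constant on $\mathbb{R}_+^\circ$; $\lim_{z\searrow0}V(z)=0=V(0)$, and the limit $\lim_{z\searrow0}V'(z)$ exists (in $\mathbb{R}$). (c) Let $D_{U,V}=\{(\langle fU(g)\rangle,\langle V(g)\rangle):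 f,g\in\mathcal{F}\}$ and $E_{U,V}=\{(\langle fU(f)\rangle,\langle V(f)\rangle): f\in\mathcal{F}\}$. Every point of $D_{U,V}$ has an open neighbourhood on which $\psi$ is twice continuously differentiable, and every point of $E_{U,V}$ has an open neighbourhood on which the gradient $(\psi_1,\psi_2)$ does not vanish. *)

theory Defs
  imports "HOL-Analysis.Analysis"
begin

type_synonym 'n rvfun = "real ^ 'n \<Rightarrow> real"

abbreviation mean :: "('n::finite) rvfun \<Rightarrow> real" where
  "mean f \<equiv> integral\<^sup>L lborel f"

definition L0_plus :: "('n::finite) rvfun set" where
  "L0_plus = {f \<in> borel_measurable borel. (\<forall>\<omega>. 0 \<le> f \<omega>) \<and> (\<exists>\<omega>. f \<omega> \<noteq> 0)}"

definition open_cube :: "(real ^ 'n::finite) set" where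
  "open_cube = {\<omega>. \<forall>i. 0 < \<omega> $ i \<and> \<omega> $ i < 1}"

definition F_zero :: "('n::finite) rvfun set" where
  "F_zero = {f \<in> L0_plus. {\<omega>. f \<omega> > 0} = open_cube \<and>
     (\<exists>a b. 0 < a \<and> (\<forall>\<omega>\<in>open_cube. a < f \<omega> \<and> f \<omega> < b))}"

text \<open>Function types do not carry a real vector space structure in the library, so convexity
  is spelled out pointwise.\<close>

definition convex_funs :: "('n::finite) rvfun set \<Rightarrow> bool" where
  "convex_funs F \<longleftrightarrow>
     (\<forall>f\<in>F. \<forall>g\<in>F. \<forall>t\<in>{0..1}. (\<lambda>\<omega>. (1 - t) * f \<omega> + t * g \<omega>) \<in> F)"

text \<open>The Bochner integral of a non-integrable function is 0, so members of this set are
  integrable.\<close>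

definition prob_part :: "('n::finite) rvfun set \<Rightarrow> 'n rvfun set" where
  "prob_part F = {p \<in> F. mean p = 1}"

definition composite_score ::
  "('n::finite) rvfun set \<Rightarrow> ('n rvfun \<Rightarrow> 'n rvfun \<Rightarrow> real) \<Rightarrow> bool" where
  "composite_score F S \<longleftrightarrow>
     (\<exists>S0 :: real ^ 'n \<Rightarrow> 'n rvfun \<Rightarrow> real. \<exists>T :: real \<Rightarrow> 'n rvfun \<Rightarrow> real.
        \<forall>f\<in>F. \<forall>g\<in>F. integrable lborel (\<lambda>\<omega>. S0 \<omega> g * f \<omega>) \<and>
          S f g = T (mean (\<lambda>\<omega>. S0 \<omega> g * f \<omega>)) g) \<and>
     (\<forall>f\<in>F. \<forall>g\<in>F. S f g \<ge> S f f) \<and>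
     (\<forall>p\<in>prob_part F. \<forall>q\<in>prob_part F. S p q = S p p \<longrightarrow> (AE \<omega> in lborel. p \<omega> = q \<omega>))"

definition divergence :: "('a \<Rightarrow> 'a \<Rightarrow> real) \<Rightarrow> 'a \<Rightarrow> 'a \<Rightarrow> real" where
  "divergence S f g = S f g - S f f"

definition moments ::
  "(real \<Rightarrow> real) \<Rightarrow> (real \<Rightarrow> real) \<Rightarrow> ('n::finite) rvfun \<Rightarrow> 'n rvfun \<Rightarrow> real \<times> real" where
  "moments U V f g = (mean (\<lambda>\<omega>. f \<omega> * U (g \<omega>)), mean (\<lambda>\<omega>. V (g \<omega>)))"

definition moments_integrable ::
  "(real \<Rightarrow> real) \<Rightarrow> (real \<Rightarrow> real) \<Rightarrow> ('n::finite) rvfun \<Rightarrow> 'n rvfun \<Rightarrow> bool" where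
  "moments_integrable U V f g \<longleftrightarrow>
     integrable lborel (\<lambda>\<omega>. f \<omega> * U (g \<omega>)) \<and> integrable lborel (\<lambda>\<omega>. V (g \<omega>))"

definition formula_score ::
  "(real \<Rightarrow> real) \<Rightarrow> (real \<Rightarrow> real) \<Rightarrow> (real \<times> real \<Rightarrow> real) \<Rightarrow>
     ('n::finite) rvfun \<Rightarrow> 'n rvfun \<Rightarrow> real" where
  "formula_score U V \<psi> f g = \<psi> (moments U V f g)"

text \<open>The function \<open>\<psi>\<close> is partial: it is represented by a total function together with
  its domain \<open>\<Psi>\<close>, and its values outside \<open>\<Psi>\<close> are meaningless.\<close>

definition formula_score_defined ::
  "(real \<Rightarrow> real) \<Rightarrow> (real \<Rightarrow> real) \<Rightarrow> (real \<times> real) set \<Rightarrow>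
     ('n::finite) rvfun \<Rightarrow> 'n rvfun \<Rightarrow> bool" where
  "formula_score_defined U V \<Psi> f g \<longleftrightarrow> moments_integrable U V f g \<and> moments U V f g \<in> \<Psi>"

definition D_set ::
  "('n::finite) rvfun set \<Rightarrow> (real \<Rightarrow> real) \<Rightarrow> (real \<Rightarrow> real) \<Rightarrow> (real \<times> real) set" where
  "D_set F U V = {moments U V f g | f g. f \<in> F \<and> g \<in> F}"

definition E_set ::
  "('n::finite) rvfun set \<Rightarrow> (real \<Rightarrow> real) \<Rightarrow> (real \<Rightarrow> real) \<Rightarrow> (real \<times> real) set" where
  "E_set F U V = {moments U V f f | f. f \<in> F}"

definition C2_pos :: "(real \<Rightarrow> real) \<Rightarrow> bool" where
  "C2_pos f \<longleftrightarrow> f differentiable_on {0<..} \<and> deriv f differentiable_on {0<..} \<and>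
     continuous_on {0<..} (deriv (deriv f))"

definition partial1 :: "(real \<times> real \<Rightarrow> real) \<Rightarrow> real \<times> real \<Rightarrow> real" where
  "partial1 \<psi> = (\<lambda>(x, y). deriv (\<lambda>s. \<psi> (s, y)) x)"

definition partial2 :: "(real \<times> real \<Rightarrow> real) \<Rightarrow> real \<times> real \<Rightarrow> real" where
  "partial2 \<psi> = (\<lambda>(x, y). deriv (\<lambda>t. \<psi> (x, t)) y)"

text \<open>The next two notions are only used on open sets \<open>N\<close>.\<close>

definition C1_plane :: "(real \<times> real) set \<Rightarrow> (real \<times> real \<Rightarrow> real) \<Rightarrow> bool" where
  "C1_plane N \<psi> \<longleftrightarrow>
     (\<forall>(x, y)\<in>N. (\<lambda>s. \<psi> (s, y)) differentiable (at x) \<and> (\<lambda>t. \<psi> (x, t)) differentiable (at y)) \<and>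
     continuous_on N (partial1 \<psi>) \<and> continuous_on N (partial2 \<psi>)"

definition C2_plane :: "(real \<times> real) set \<Rightarrow> (real \<times> real \<Rightarrow> real) \<Rightarrow> bool" where
  "C2_plane N \<psi> \<longleftrightarrow> C1_plane N \<psi> \<and> C1_plane N (partial1 \<psi>) \<and> C1_plane N (partial2 \<psi>)"

definition affine_density ::
  "real ^ 'n ^ 'n \<Rightarrow> real ^ 'n \<Rightarrow> ('n::finite) rvfun \<Rightarrow> 'n rvfun" where
  "affine_density \<sigma> \<mu> p = (\<lambda>\<omega>. \<bar>det \<sigma>\<bar> * p (\<sigma> *v \<omega> + \<mu>))"

text \<open>The transformed densities need not belong to \<open>F\<close>, so the divergence between them is the
  one given by the formula in \<open>U\<close>, \<open>V\<close>, \<open>\<psi>\<close>, which is required to make sense for both scores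
  entering the divergence.\<close>

definition affine_invariant_divergence ::
  "('n::finite) rvfun set \<Rightarrow> ('n rvfun \<Rightarrow> 'n rvfun \<Rightarrow> real) \<Rightarrow> (real \<Rightarrow> real) \<Rightarrow> (real \<Rightarrow> real) \<Rightarrow>
     (real \<times> real) set \<Rightarrow> (real \<times> real \<Rightarrow> real) \<Rightarrow> bool" where
  "affine_invariant_divergence F S U V \<Psi> \<psi> \<longleftrightarrow>
     (\<exists>h :: real ^ 'n ^ 'n \<Rightarrow> real ^ 'n \<Rightarrow> real. \<forall>\<sigma> \<mu>. invertible \<sigma> \<longrightarrow>
        0 < h \<sigma> \<mu> \<and>
        (\<forall>p\<in>prob_part F. \<forall>q\<in>prob_part F.
           formula_score_defined U V \<Psi> (affine_density \<sigma> \<mu> p) (affine_density \<sigma> \<mu> q) \<and>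
           formula_score_defined U V \<Psi> (affine_density \<sigma> \<mu> p) (affine_density \<sigma> \<mu> p) \<and>
           h \<sigma> \<mu> * divergence (formula_score U V \<psi>) (affine_density \<sigma> \<mu> p) (affine_density \<sigma> \<mu> q)
             = divergence S p q))"

end

theory Submission imports Defs
begin

text \<open>A score of the given form is determined on step densities by finitely many values: if \<open>f\<close>
  and \<open>g\<close> are constant on \<open>N\<close> slabs of equal volume, with values \<open>x j\<close> and \<open>y j\<close>, then both
  arguments of \<open>\<psi>\<close> are finite sums, and a dilation that multiplies volumes by \<open>s\<close> replaces the
  values by \<open>s * x j\<close> and \<open>s * y j\<close> and divides the volumes of the slabs by \<open>s\<close>. Step densities
  belong to \<open>F\<close> and can take any prescribed positive values, so calculus in finitely many real
  variables is enough.

  First order. For fixed \<open>f\<close> the function \<open>S f g\<close> is minimal at \<open>g = f\<close>. Varying \<open>g\<close> shows that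
  the gradient of \<open>\<psi>\<close> is orthogonal to \<open>(z U' z, V' z)\<close> for each value \<open>z\<close> of \<open>f\<close>. The gradient
  does not vanish, and so all these vectors are parallel: \<open>V' z = \<kappa> z U' z\<close> with a constant
  \<open>\<kappa> \<noteq> 0\<close> (\<open>proper_imp_derivs_proportional\<close>).

  Second order. Take a probability density \<open>p\<close> that has the value \<open>z\<close> on two slabs and move mass
  from one of them to the other. In this direction all first variations vanish, and the second
  variation of the divergence is \<open>\<kappa> \<psi>\<^sub>2\<close> times \<open>U' z\<close>, up to a factor that does not depend on \<open>z\<close>;
  after a dilation by \<open>s\<close> the same holds with \<open>U' (s z)\<close> (\<open>score_second_variation\<close>). Invariance
  makes the two second variations proportional with a factor that depends on \<open>s\<close> and \<open>p\<close> alone, so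
  that \<open>U' z1 * U' (s z2) = U' z2 * U' (s z1)\<close> for any two values \<open>z1\<close> and \<open>z2\<close> of \<open>p\<close>
  (\<open>invariance_imp_ratio\<close>). Differentiation at \<open>s = 1\<close> gives \<open>z U'' z = \<beta> U' z\<close> and hence
  \<open>U' z = a z powr \<beta>\<close> (\<open>constant_ratio_imp_power\<close>).

  A dilated density need not belong to \<open>F\<close>, so smoothness of \<open>\<psi>\<close> at its moments and the relation
  \<open>\<psi>\<^sub>1 + \<kappa> \<psi>\<^sub>2 = 0\<close> there need an argument. The former holds for \<open>s\<close> near \<open>1\<close> by continuity. The
  latter follows from minimality of the divergence along mass-preserving directions, if \<open>z U' z\<close>
  is not constant; if it is constant, \<open>U' z = a / z\<close> at once.

  Finally, \<open>U\<close> and \<open>V\<close> are found by integration; the assumptions on \<open>V\<close> at \<open>0\<close> leave \<open>\<beta> \<ge> -1\<close> and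
  no additive constant in \<open>V\<close>, and \<open>\<beta> = -1\<close> is the logarithmic case (\<open>integrate_power_solution\<close>).\<close>

section \<open>Step densities on the unit cube\<close>

text \<open>The cube is cut along the coordinate \<open>k\<close> into \<open>N\<close> slabs of equal volume, numbered
  \<open>0, \<dots>, N - 1\<close>, and \<open>x j\<close> is the value on slab \<open>j\<close>; the values \<open>x j\<close> with \<open>j \<ge> N\<close> never occur.
  One coordinate is enough because all moments depend only on the distribution of values, whatever
  the dimension.\<close>

definition step_density :: "nat \<Rightarrow> 'n::finite \<Rightarrow> (nat \<Rightarrow> real) \<Rightarrow> 'n rvfun" where
  "step_density N k x \<omega> = (if \<omega> \<in> open_cube then x (nat \<lfloor>real N * \<omega> $ k\<rfloor>) else 0)"

lemma slab_index_bound: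
  assumes "\<omega> \<in> open_cube" and "N > 0"
  shows "nat \<lfloor>real N * \<omega> $ k\<rfloor> < N"
proof -
  have "0 < \<omega> $ k" "\<omega> $ k < 1" using assms(1) by (auto simp: open_cube_def)
  then have "real N * \<omega> $ k < real N" using assms(2) by simp
  then have "\<lfloor>real N * \<omega> $ k\<rfloor> < int N" by linarith
  then show ?thesis using assms(2) by linarith
qed

lemma step_density_comp:
  "G 0 = 0 \<Longrightarrow> G (step_density N k x \<omega>) = step_density N k (\<lambda>j. G (x j)) \<omega>"
  "step_density N k x \<omega> * G' (step_density N k y \<omega>) = step_density N k (\<lambda>j. x j * G' (y j)) \<omega>"
  "c * step_density N k x \<omega> = step_density N k (\<lambda>j. c * x j) \<omega>"
  by (simp_all add: step_density_def)

text \<open>Boxes have a known volume, whereas a slab that contains one of its two faces is not a box. A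
  slab is therefore treated as the difference of two of these initial pieces.\<close>

lemma lower_slab:
  fixes k :: "'n::finite"
  assumes "0 \<le> t" "t \<le> 1"
  defines "H \<equiv> {\<omega> \<in> open_cube. \<omega> $ k < t}"
  shows "H \<in> sets lborel" and "emeasure lborel H < \<infinity>" and "measure lborel H = t"
proof -
  let ?u = "\<chi> i. if i = k then t else 1"
  have H: "H = box 0 ?u"
  proof (intro set_eqI iffI)
    fix \<omega> assume \<omega>: "\<omega> \<in> box 0 ?u"
    then have *: "0 < \<omega> $ i \<and> \<omega> $ i < (if i = k then t else 1)" for i
      by (simp add: mem_box_cart)
    have "\<omega> $ i < 1" for i
      using *[of i] assms(2) by (cases "i = k") auto
    then show "\<omega> \<in> H"
      using * *[of k] by (simp add: H_def open_cube_def)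
  qed (simp add: H_def open_cube_def mem_box_cart)
  show "H \<in> sets lborel" "emeasure lborel H < \<infinity>"
    unfolding H by (simp_all only: emeasure_lborel_box_finite sets_lborel borel_open open_box)
  have ne: "cbox 0 ?u \<noteq> {}" using assms by (auto simp: interval_ne_empty_cart)
  have "measure lborel H = measure lborel (cbox 0 ?u)"
    by (simp only: H measure_lborel_box_eq measure_lborel_cbox_eq)
  also have "\<dots> = t"
    by (subst content_cbox_cart[OF ne]) simp
  finally show "measure lborel H = t" .
qed

lemma step_density_integral:
  fixes k :: "'n::finite"
  assumes "N > 0"
  shows "has_bochner_integral lborel (step_density N k x) ((\<Sum>j<N. x j) / real N)"
proof -
  define H where "H t = {\<omega> \<in> open_cube. \<omega> $ k < t}" for t :: real
  have slab: "has_bochner_integral lborel (\<lambda>\<omega>. x j * (indicat_real (H (real (Suc j) / N)) \<omega> -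
      indicat_real (H (real j / N)) \<omega>))
          (x j * (real (Suc j) / N - real j / N))" if "j < N" for j
  proof -
    have b: "0 \<le> real j / N" "real j / N \<le> 1" "0 \<le> real (Suc j) / N" "real (Suc j) / N \<le> 1"
      using that by simp_all
    show ?thesis
      using has_bochner_integral_real_indicator[OF lower_slab(1,2)[OF b(1,2), of k]]
        has_bochner_integral_real_indicator[OF lower_slab(1,2)[OF b(3,4), of k]]
      unfolding lower_slab(3)[OF b(1,2)] lower_slab(3)[OF b(3,4)] H_def
      by (intro has_bochner_integral_mult_right has_bochner_integral_diff)
  qed
  have "has_bochner_integral lborel
      (\<lambda>\<omega>. \<Sum>j<N. x j * (indicat_real (H (real (Suc j) / N)) \<omega> - indicat_real (H (real j / N)) \<omega>))
      (\<Sum>j<N. x j * (real (Suc j) / N - real j / N))"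
    using slab by (intro has_bochner_integral_sum) auto
  also have "(\<lambda>\<omega>. \<Sum>j<N. x j * (indicat_real (H (real (Suc j) / N)) \<omega> - indicat_real (H (real j /
      N)) \<omega>))
      = step_density N k x"
  proof
    fix \<omega> :: "real ^ 'n"
    have ind: "indicat_real (H (real (Suc j) / N)) \<omega> - indicat_real (H (real j / N)) \<omega>
        = (if \<omega> \<in> open_cube \<and> j = nat \<lfloor>real N * \<omega> $ k\<rfloor> then 1 else 0)" for j
    proof (cases "\<omega> \<in> open_cube")
      case True
      then have "0 < \<omega> $ k" by (auto simp: open_cube_def)
      then have pos: "0 < real N * \<omega> $ k" using assms by simp
      have lt: "\<omega> $ k < real i / N \<longleftrightarrow> real N * \<omega> $ k < real i" for i
        using assms by (simp add: field_simps)
      have "j = nat \<lfloor>real N * \<omega> $ k\<rfloor> \<longleftrightarrow> real j \<le> real N * \<omega> $ k \<and> real N * \<omega> $ k < real (Suc j)"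
        using pos by linarith
      then show ?thesis
        using True unfolding H_def indicator_def mem_Collect_eq lt by auto
    qed (simp add: H_def)
    show "(\<Sum>j<N. x j * (indicat_real (H (real (Suc j) / N)) \<omega> - indicat_real (H (real j / N)) \<omega>))
        = step_density N k x \<omega>"
      unfolding ind
      using slab_index_bound[of \<omega> N k] assms
      by (simp add: step_density_def if_distrib[of "\<lambda>u. _ * u"] sum.delta cong: if_cong)
  qed
  also have "(\<Sum>j<N. x j * (real (Suc j) / N - real j / N)) = (\<Sum>j<N. x j) / real N"
    by (simp add: sum_divide_distrib diff_divide_distrib[symmetric])
  finally show ?thesis .
qed

lemma step_density_in_F_zero:
  assumes "N > 0" and pos: "\<And>j. j < N \<Longrightarrow> 0 < x j"
  shows "step_density N k x \<in> F_zero"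
proof -
  let ?f = "step_density N k x"
  have range: "?f \<omega> \<in> x ` {..<N}" if "\<omega> \<in> open_cube" for \<omega>
    using that slab_index_bound[OF that assms(1), of k] by (auto simp: step_density_def)
  have ne: "x ` {..<N} \<noteq> {}" using assms(1) by auto
  have bounds: "0 < Min (x ` {..<N}) / 2" "\<forall>\<omega>\<in>open_cube. Min (x ` {..<N}) / 2 < ?f \<omega> \<and>
      ?f \<omega> < Max (x ` {..<N}) + 1"
  proof -
    show p: "0 < Min (x ` {..<N}) / 2" using pos ne by simp
    show "\<forall>\<omega>\<in>open_cube. Min (x ` {..<N}) / 2 < ?f \<omega> \<and> ?f \<omega> < Max (x ` {..<N}) + 1"
    proof
      fix \<omega> :: "real ^ 'a" assume "\<omega> \<in> open_cube"
      then have "Min (x ` {..<N}) \<le> ?f \<omega>" "?f \<omega> \<le> Max (x ` {..<N})"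
        using range by (auto intro!: Min_le Max_ge)
      then show "Min (x ` {..<N}) / 2 < ?f \<omega> \<and> ?f \<omega> < Max (x ` {..<N}) + 1"
        using p by linarith
    qed
  qed
  have posf: "?f \<omega> > 0" if "\<omega> \<in> open_cube" for \<omega>
    using bounds that by fastforce
  have out: "?f \<omega> = 0" if "\<omega> \<notin> open_cube" for \<omega>
    using that by (simp add: step_density_def)
  have "(\<chi> i. 1/2) \<in> (open_cube :: (real^'a) set)" by (simp add: open_cube_def)
  then have "\<exists>\<omega>. ?f \<omega> \<noteq> 0" using posf by (metis less_numeral_extra(3))
  moreover have "?f \<in> borel_measurable borel"
    using step_density_integral[OF assms(1), of k x]
        by (simp add: has_bochner_integral_iff borel_measurable_integrable[of lborel, simplified])
  moreover have "\<forall>\<omega>. 0 \<le> ?f \<omega>" using posf out by (metis less_eq_real_def order_refl)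
  moreover have "{\<omega>. ?f \<omega> > 0} = open_cube"
  proof (intro set_eqI)
    show "\<omega> \<in> {\<omega>. ?f \<omega> > 0} \<longleftrightarrow> \<omega> \<in> open_cube" for \<omega> :: "real ^ 'a"
      using posf[of \<omega>] out[of \<omega>] by (cases "\<omega> \<in> open_cube") auto
  qed
  ultimately show ?thesis
    using bounds unfolding F_zero_def L0_plus_def by blast
qed

section \<open>Moments of dilated step densities\<close>

lemma integral_dilation:
  fixes G :: "'n::finite rvfun"
  assumes "has_bochner_integral lborel G I" and "t > 0"
  shows "integral\<^sup>L lborel (\<lambda>\<omega>. G (t *\<^sub>R \<omega>)) = I / t ^ CARD('n)"
proof -
  have [measurable]: "G \<in> borel_measurable borel"
    using assms(1) by (simp add: has_bochner_integral_iff borel_measurable_integrable[of lborel,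
        simplified])
  have "integral\<^sup>L lborel G = integral\<^sup>L (density (distr lborel borel (\<lambda>x. 0 + t *\<^sub>R x)) (\<lambda>_. \<bar>t\<bar>
      ^ DIM(real^'n))) G"
    using lborel_affine[of t "0 :: real^'n"] assms(2) by simp
  also have "\<dots> = t ^ CARD('n) * integral\<^sup>L lborel (\<lambda>\<omega>. G (t *\<^sub>R \<omega>))"
    using assms(2) by (simp add: integral_density integral_distr)
  finally show ?thesis
    using assms by (simp add: has_bochner_integral_iff field_simps)
qed

text \<open>The arguments of \<open>\<psi>\<close> for a pair of step densities that were both compressed by the factor
  \<open>s\<close> in volume: a compressed density has its values multiplied by \<open>s\<close> on a set whose volume is
  divided by \<open>s\<close>. In the first component the factor \<open>s\<close> of the density itself cancels the factor
  \<open>1 / s\<close>; in the second component \<open>1 / s\<close> stays.\<close>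

definition step_moments :: "(real \<Rightarrow> real) \<Rightarrow> (real \<Rightarrow> real) \<Rightarrow> nat \<Rightarrow> real \<Rightarrow> (nat \<Rightarrow> real) \<Rightarrow> (nat \<Rightarrow>
    real) \<Rightarrow> real \<times> real" where
  "step_moments U V N s x y =
     ((\<Sum>j<N. x j * U (s * y j)) / real N, (\<Sum>j<N. V (s * y j)) / (real N * s))"

text \<open>The condition \<open>V 0 = 0\<close> is what makes the complement of the cube, which has infinite volume,
  contribute nothing.\<close>

lemma moments_dilated_step_density:
  fixes k :: "'n::finite"
  assumes "N > 0" and "t > 0" and "V 0 = 0"
  shows "moments U V (affine_density (mat t) 0 (step_density N k x)) (affine_density (mat t) 0
      (step_density N k y))
    = step_moments U V N (t ^ CARD('n)) x y"
proof -
  define s where "s = t ^ CARD('n)"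
  have s: "s > 0" using assms(2) by (simp add: s_def)
  have dens: "affine_density (mat t) 0 (step_density N k x) \<omega> =
      step_density N k (\<lambda>j. s * x j) (t *\<^sub>R \<omega>)" for x and \<omega> :: "real^'n"
  proof -
    have "det (mat t :: real^'n^'n) = s" by (subst det_diagonal) (auto simp: mat_def s_def)
    moreover have "(mat t :: real^'n^'n) *v \<omega> = t *\<^sub>R \<omega>"
      by (simp add: vec_eq_iff matrix_vector_mult_def mat_def if_distrib[of "\<lambda>u. u * _"]
          cong: if_cong)
    ultimately show ?thesis
      using s by (simp add: affine_density_def step_density_comp(3)[symmetric])
  qed
  have "mean (\<lambda>\<omega>. affine_density (mat t) 0 (step_density N k x) \<omega> * U (affine_density (mat t) 0
      (step_density N k y) \<omega>))
     = ((\<Sum>j<N. s * x j * U (s * y j)) / real N) / s"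
    unfolding dens step_density_comp(2) using assms(2)
    unfolding s_def by (rule integral_dilation[OF step_density_integral[OF assms(1)]])
  moreover have "mean (\<lambda>\<omega>. V (affine_density (mat t) 0 (step_density N k y) \<omega>))
     = ((\<Sum>j<N. V (s * y j)) / real N) / s"
    unfolding dens step_density_comp(1)[of V, OF assms(3)] using assms(2)
    unfolding s_def by (rule integral_dilation[OF step_density_integral[OF assms(1)]])
  ultimately show ?thesis
    using s by (simp add: moments_def step_moments_def s_def[symmetric]
        mult.assoc sum_distrib_left[symmetric])
qed

lemma moments_step_density:
  fixes k :: "'n::finite"
  assumes "N > 0" and "V 0 = 0"
  shows "moments U V (step_density N k x) (step_density N k y) = step_moments U V N 1 x y"
  using moments_dilated_step_density[of N 1 V U k x y, OF assms(1) _ assms(2)]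
  by (simp add: affine_density_def)

section \<open>Variation of the score along a line of step densities\<close>

lemma C2_pos_DERIV:
  assumes "C2_pos f" and "z > 0"
  shows "(f has_real_derivative deriv f z) (at z)"
    and "(deriv f has_real_derivative deriv (deriv f) z) (at z)"
  using assms at_within_open[of z "{0<..}"]
  unfolding C2_pos_def DERIV_deriv_iff_real_differentiable differentiable_on_def
  by (metis greaterThan_iff open_greaterThan)+

text \<open>Continuity of the two partial derivatives makes \<open>\<psi>\<close> differentiable in both variables
  jointly, and the ordinary chain rule then applies. Joint differentiability is obtained on a
  product of an open set with a ball, because one of the factors must be convex.\<close>

lemma C1_plane_chain:
  assumes "open M" and C1: "C1_plane M \<psi>" and mem: "(A t, B t) \<in> M"
    and A: "(A has_real_derivative a) (at t)" and B: "(B has_real_derivative b) (at t)"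
  shows "((\<lambda>t. \<psi> (A t, B t)) has_real_derivative
           partial1 \<psi> (A t, B t) * a + partial2 \<psi> (A t, B t) * b) (at t)"
proof -
  let ?p = "(A t, B t)"
  obtain X Y' where XY': "open X" "open Y'" "A t \<in> X" "B t \<in> Y'" "X \<times> Y' \<subseteq> M"
    using open_prod_elim[OF assms(1) mem] by (metis mem_Sigma_iff)
  then obtain e where e: "e > 0" "ball (B t) e \<subseteq> Y'"
    by (meson open_contains_ball)
  define Y where "Y = ball (B t) e"
  have Y: "open Y" "B t \<in> Y" "convex Y" "X \<times> Y \<subseteq> M" and X: "open X" "A t \<in> X"
    using XY' e by (auto simp: Y_def)
  have d1: "((\<lambda>s. \<psi> (s, y)) has_real_derivative partial1 \<psi> (x, y)) (at x)"
    and d2: "((\<lambda>u. \<psi> (x, u)) has_real_derivative partial2 \<psi> (x, y)) (at y)" if "(x, y) \<in> M" for x y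
    using C1 that unfolding C1_plane_def partial1_def partial2_def
    by (auto simp: DERIV_deriv_iff_real_differentiable)
  have cont: "continuous (at ?p within X \<times> Y) (partial2 \<psi>)"
    using C1 Y X continuous_on_subset[of M "partial2 \<psi>" "X \<times> Y"]
    by (auto simp: C1_plane_def continuous_on_eq_continuous_within)
  have "((\<lambda>(x, y). \<psi> (x, y)) has_derivative
      (\<lambda>(h, k). partial1 \<psi> ?p * h + blinfun_mult_right (partial2 \<psi> (A t, B t)) k)) (at ?p within X
      \<times> Y)"
  proof (rule has_derivative_partialsI[where f = "\<lambda>x y. \<psi> (x, y)" and fy =
      "\<lambda>x y. blinfun_mult_right (partial2 \<psi> (x, y))"])
    show "((\<lambda>x. \<psi> (x, B t)) has_derivative (*) (partial1 \<psi> ?p)) (at (A t) within X)"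
      using d1[OF mem] has_field_derivative_at_within
          unfolding has_field_derivative_def[symmetric] by blast
    show "((\<lambda>y. \<psi> (x, y)) has_derivative blinfun_apply (blinfun_mult_right (partial2 \<psi> (x,
        y)))) (at y within Y)"
      if "x \<in> X" "y \<in> Y" for x y
    proof -
      have "(x, y) \<in> M" using that Y by auto
      then have "((\<lambda>u. \<psi> (x, u)) has_derivative (*) (partial2 \<psi> (x, y))) (at y within Y)"
        using d2 has_field_derivative_at_within unfolding has_field_derivative_def[symmetric]
            by blast
      then show ?thesis by (simp add: blinfun_mult_right.rep_eq)
    qed
    show "continuous (at ?p within X \<times> Y) (\<lambda>(x, y). blinfun_mult_right (partial2 \<psi> (x, y)))"
      using bounded_linear.continuous[OF bounded_linear_blinfun_mult_right cont]
      by (simp add: case_prod_unfold)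
  qed (use Y in auto)
  then have "(\<psi> has_derivative (\<lambda>(h, k). partial1 \<psi> ?p * h + partial2 \<psi> ?p * k)) (at ?p)"
    using X Y at_within_open[of ?p "X \<times> Y"] by (simp add: blinfun_mult_right.rep_eq open_Times)
  then have "((\<lambda>t. \<psi> (A t, B t)) has_derivative (\<lambda>h. (\<lambda>(h, k). partial1 \<psi> ?p * h + partial2 \<psi> ?p *
      k) (a * h, b * h))) (at t)"
    by (rule has_derivative_compose[rotated])
       (use A B in \<open>auto simp: has_field_derivative_def intro!: has_derivative_Pair\<close>)
  moreover have "(\<lambda>h. (\<lambda>(h, k). partial1 \<psi> ?p * h + partial2 \<psi> ?p * k) (a * h, b * h))
      = (*) (partial1 \<psi> ?p * a + partial2 \<psi> ?p * b)"
    by (simp add: fun_eq_iff algebra_simps)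
  ultimately show ?thesis
    by (simp only: has_field_derivative_def)
qed

text \<open>The factor \<open>s\<close> from the inner derivative survives only in the first moment; in the second it
  cancels against the factor \<open>1 / s\<close>.\<close>

lemma step_moments_perturbed:
  assumes U: "C2_pos U" and V: "C2_pos V" and "N > 0" and "s > 0"
    and pos: "\<And>j. j < N \<Longrightarrow> 0 < y j + t * r j"
  shows "((\<lambda>t. fst (step_moments U V N s x (\<lambda>j. y j + t * r j))) has_real_derivative
           s / N * (\<Sum>j<N. x j * r j * deriv U (s * (y j + t * r j)))) (at t)"
    and "((\<lambda>t. snd (step_moments U V N s x (\<lambda>j. y j + t * r j))) has_real_derivative
           1 / N * (\<Sum>j<N. r j * deriv V (s * (y j + t * r j)))) (at t)"
proof -
  have comp: "((\<lambda>t. f (s * (y j + t * r j))) has_real_derivative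
      deriv f (s * (y j + t * r j)) * (s * r j)) (at t)"
    if "C2_pos f" "j < N" for f j
    by (rule DERIV_chain2[OF C2_pos_DERIV(1)[OF that(1)]])
       (use pos[OF that(2)] assms(4) in \<open>auto intro!: derivative_eq_intros\<close>)
  have "((\<lambda>t. (\<Sum>j<N. x j * U (s * (y j + t * r j))) / real N) has_real_derivative
     (\<Sum>j<N. x j * (deriv U (s * (y j + t * r j)) * (s * r j))) / real N) (at t)"
    by (intro DERIV_cdivide DERIV_sum DERIV_cmult comp U) auto
  then show "((\<lambda>t. fst (step_moments U V N s x (\<lambda>j. y j + t * r j))) has_real_derivative
           s / N * (\<Sum>j<N. x j * r j * deriv U (s * (y j + t * r j)))) (at t)"
    by (simp add: step_moments_def sum_distrib_left mult_ac sum_divide_distrib)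
  have "((\<lambda>t. (\<Sum>j<N. V (s * (y j + t * r j))) / (real N * s)) has_real_derivative
     (\<Sum>j<N. deriv V (s * (y j + t * r j)) * (s * r j)) / (real N * s)) (at t)"
    by (intro DERIV_cdivide DERIV_sum comp V) auto
  then show "((\<lambda>t. snd (step_moments U V N s x (\<lambda>j. y j + t * r j))) has_real_derivative
           1 / N * (\<Sum>j<N. r j * deriv V (s * (y j + t * r j)))) (at t)"
    using assms(4) by (simp add: step_moments_def sum_distrib_left mult_ac sum_divide_distrib)
qed

lemma score_perturbed:
  fixes x y r :: "nat \<Rightarrow> real"
  assumes "C2_pos U" and "C2_pos V" and "N > 0" and "s > 0"
    and "\<And>j. j < N \<Longrightarrow> 0 < y j + t * r j"
    and "open M" and "C1_plane M \<psi>"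
  defines "E \<equiv> \<lambda>t. step_moments U V N s x (\<lambda>j. y j + t * r j)"
  assumes "E t \<in> M"
  shows "((\<lambda>t. \<psi> (E t)) has_real_derivative
           partial1 \<psi> (E t) * (s / N * (\<Sum>j<N. x j * r j * deriv U (s * (y j + t * r j)))) +
           partial2 \<psi> (E t) * (1 / N * (\<Sum>j<N. r j * deriv V (s * (y j + t * r j))))) (at t)"
proof -
  have "(fst (E t), snd (E t)) \<in> M" using assms(9) by simp
  from C1_plane_chain[OF assms(6,7), of "\<lambda>t. fst (E t)" t "\<lambda>t. snd (E t)", OF this]
    step_moments_perturbed[OF assms(1-4), of y t r x] assms(5)
  show ?thesis unfolding E_def by fastforce
qed

lemma eventually_perturbation_pos:
  fixes x r :: "nat \<Rightarrow> real"
  assumes "\<And>j. j < N \<Longrightarrow> 0 < x j"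
  shows "\<forall>\<^sub>F t in nhds 0. \<forall>j<N. 0 < x j + t * r j"
proof -
  have "\<forall>\<^sub>F t in nhds 0. 0 < x j + t * r j" if "j < N" for j
  proof -
    have "((\<lambda>t. x j + t * r j) \<longlongrightarrow> x j + 0 * r j) (nhds 0)"
      by (intro tendsto_intros filterlim_ident)
    then show ?thesis
      using order_tendstoD(1) assms[OF that] by fastforce
  qed
  then have "\<forall>\<^sub>F t in nhds 0. \<forall>j\<in>{..<N}. 0 < x j + t * r j"
    by (intro eventually_ball_finite) auto
  then show ?thesis by (simp only: Ball_def lessThan_iff)
qed

text \<open>The first-order condition for \<open>x\<close> to minimise the score among the densities \<open>x + t r\<close>. Only
  the direction \<open>r\<close> enters, so the lemma covers both unrestricted minimality, which propriety
  gives for \<open>s = 1\<close>, and minimality among perturbations that preserve the total mass, which is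
  what survives for the dilated densities.\<close>

lemma optimality_condition:
  assumes "C2_pos U" and "C2_pos V" and "N > 0" and "s > 0"
    and pos: "\<And>j. j < N \<Longrightarrow> 0 < x j"
    and "open M" and "C1_plane M \<psi>" and mem: "step_moments U V N s x x \<in> M"
    and min: "\<And>t. (\<And>j. j < N \<Longrightarrow> 0 < x j + t * r j) \<Longrightarrow>
      \<psi> (step_moments U V N s x x) \<le> \<psi> (step_moments U V N s x (\<lambda>j. x j + t * r j))"
  shows "s * partial1 \<psi> (step_moments U V N s x x) * (\<Sum>j<N. x j * r j * deriv U (s * x j)) +
         partial2 \<psi> (step_moments U V N s x x) * (\<Sum>j<N. r j * deriv V (s * x j)) = 0" (is "?L = 0")
proof -
  have "((\<lambda>t. \<psi> (step_moments U V N s x (\<lambda>j. x j + t * r j))) has_real_derivative ?L / N) (at 0)"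
    using score_perturbed[OF assms(1-4), of x 0 r M \<psi> x] assms(6,7) pos mem
    by (simp add: field_simps add_divide_distrib)
  moreover obtain d where "d > 0" "\<And>t. dist t 0 < d \<Longrightarrow> \<forall>j<N. 0 < x j + t * r j"
    using eventually_perturbation_pos[of N x r, OF pos] unfolding eventually_nhds_metric by blast
  then have "d > 0" "\<forall>t. \<bar>0 - t\<bar> < d \<longrightarrow> \<psi> (step_moments U V N s x (\<lambda>j. x j + 0 * r j)) \<le>
      \<psi> (step_moments U V N s x (\<lambda>j. x j + t * r j))"
    using min by (simp_all add: dist_real_def)
  ultimately have "?L / N = 0" by (rule DERIV_local_min)
  then show ?thesis using assms(3) by simp
qed

section \<open>Propriety couples the two functions\<close>

lemma nonconstant_deriv:
  assumes "C2_pos f" and "\<not> f constant_on {0<..}"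
  obtains z where "z > 0" and "deriv f z \<noteq> 0"
proof -
  have "\<exists>c. \<forall>z\<in>{0<..}. f z = c" if "\<And>z. z > 0 \<Longrightarrow> deriv f z = 0"
  proof (rule has_field_derivative_zero_constant)
    fix z :: real assume "z \<in> {0<..}"
    then show "(f has_real_derivative 0) (at z within {0<..})"
      using C2_pos_DERIV(1)[OF assms(1), of z] that[of z]
          by (simp add: has_field_derivative_at_within)
  qed (rule convex_real_interval)
  then show ?thesis
    using assms(2) that unfolding constant_on_def by blast
qed

text \<open>For a density \<open>f\<close> with the two values \<open>z0\<close> and \<open>z\<close>, the score of \<open>g\<close> is minimal at \<open>g = f\<close>,
  and varying each value of \<open>g\<close> separately shows that the gradient of \<open>\<psi>\<close> is orthogonal to both
  \<open>(z0 U' z0, V' z0)\<close> and \<open>(z U' z, V' z)\<close>. As the gradient is not zero, these two vectors are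
  parallel. Fixing \<open>z0\<close> with \<open>U' z0 \<noteq> 0\<close> gives one factor for all \<open>z\<close>.\<close>

lemma proper_imp_derivs_proportional:
  assumes U: "C2_pos U" "\<not> U constant_on {0<..}" and V: "C2_pos V" "\<not> V constant_on {0<..}"
    and proper: "\<And>N x y. N > 0 \<Longrightarrow> (\<And>j. j < N \<Longrightarrow> 0 < x j) \<Longrightarrow> (\<And>j. j < N \<Longrightarrow> 0 < y j) \<Longrightarrow>
      \<psi> (step_moments U V N 1 x x) \<le> \<psi> (step_moments U V N 1 x y)"
    and reg: "\<And>N x. N > 0 \<Longrightarrow> (\<And>j. j < N \<Longrightarrow> 0 < x j) \<Longrightarrow>
      \<exists>M. open M \<and> step_moments U V N 1 x x \<in> M \<and> C1_plane M \<psi> \<and>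
        (\<forall>y\<in>M. (partial1 \<psi> y, partial2 \<psi> y) \<noteq> (0, 0))"
  obtains \<kappa> where "\<kappa> \<noteq> 0" and "\<And>z. z > 0 \<Longrightarrow> deriv V z = \<kappa> * (z * deriv U z)"
proof -
  obtain z0 where z0: "z0 > 0" "deriv U z0 \<noteq> 0" using nonconstant_deriv[OF U] .
  obtain v0 where v0: "v0 > 0" "deriv V v0 \<noteq> 0" using nonconstant_deriv[OF V] .
  have rel: "z0 * deriv U z0 * deriv V z = z * deriv U z * deriv V z0" if "z > 0" for z
  proof -
    define x where "x = (\<lambda>j::nat. if j = 0 then z0 else z)"
    have pos: "0 < x j" for j using z0 that by (simp add: x_def)
    obtain M where M: "open M" "step_moments U V 2 1 x x \<in> M" "C1_plane M \<psi>"
      "\<forall>y\<in>M. (partial1 \<psi> y, partial2 \<psi> y) \<noteq> (0, 0)"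
      using reg[of 2 x] pos by auto
    define p q where "p = partial1 \<psi> (step_moments U V 2 1 x x)"
      and "q = partial2 \<psi> (step_moments U V 2 1 x x)"
    have opt: "p * (\<Sum>j<2. x j * r j * deriv U (x j)) + q * (\<Sum>j<2. r j * deriv V (x j)) = 0" for r
      using optimality_condition[OF U(1) V(1), of 2 1 x M \<psi> r] pos M proper[of 2 x]
      by (simp add: p_def q_def)
    have "p * (z0 * deriv U z0) + q * deriv V z0 = 0"
      using opt[of "\<lambda>j. if j = 0 then 1 else 0"] by (simp add: numeral_2_eq_2 x_def)
    moreover have "p * (z * deriv U z) + q * deriv V z = 0"
      using opt[of "\<lambda>j. if j = 0 then 0 else 1"] by (simp add: numeral_2_eq_2 x_def)
    moreover have "p \<noteq> 0 \<or> q \<noteq> 0" using M(2,4) by (auto simp: p_def q_def)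
    ultimately show ?thesis by algebra
  qed
  define \<kappa> where "\<kappa> = deriv V z0 / (z0 * deriv U z0)"
  have \<kappa>: "deriv V z = \<kappa> * (z * deriv U z)" if "z > 0" for z
    using rel[OF that] z0 by (simp add: \<kappa>_def field_simps)
  moreover have "\<kappa> \<noteq> 0" using \<kappa>[OF v0(1)] v0(2) by auto
  ultimately show ?thesis using that by blast
qed

section \<open>Second variation and dilations\<close>

text \<open>The second variation is expressed as the limit of \<open>\<phi>' t / t\<close>. Write \<open>a t\<close> for the first
  variation \<open>\<Sum> x r U'(s (x + t r))\<close> and \<open>b t\<close> for \<open>\<Sum> r\<^sup>2 U'(s (x + t r))\<close>. Because \<open>V'\<close> is
  \<open>\<kappa> z U'\<close>, the derivative of the second moment is the multiple \<open>\<kappa> s / N\<close> of \<open>a t + t b t\<close>, so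
  \<open>\<phi>' t / t\<close> is \<open>s / N\<close> times \<open>(\<psi>\<^sub>1 + \<kappa> \<psi>\<^sub>2) (a t / t) + \<kappa> \<psi>\<^sub>2 b t\<close>. The first summand vanishes in
  the limit: its bracket tends to \<open>0\<close>, and \<open>a t / t\<close> tends to \<open>a' 0\<close> since \<open>a 0 = 0\<close>. In this way
  neither the second derivatives of \<open>\<psi>\<close> nor those of \<open>U\<close> appear in the result.\<close>

lemma score_second_variation:
  fixes x r :: "nat \<Rightarrow> real"
  assumes U: "C2_pos U" and V: "C2_pos V" and N: "N > 0" and s: "s > 0"
    and pos: "\<And>j. j < N \<Longrightarrow> 0 < x j"
    and M: "open M" "C1_plane M \<psi>"
    and dV: "\<And>z. z > 0 \<Longrightarrow> deriv V z = \<kappa> * (z * deriv U z)"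
  defines "E \<equiv> \<lambda>t. step_moments U V N s x (\<lambda>j. x j + t * r j)"
  assumes mem: "E 0 \<in> M"
    and stat: "partial1 \<psi> (E 0) + \<kappa> * partial2 \<psi> (E 0) = 0"
    and crit: "(\<Sum>j<N. x j * r j * deriv U (s * x j)) = 0"
  shows "\<exists>\<phi>'. (\<forall>\<^sub>F t in nhds 0. ((\<lambda>t. \<psi> (E t)) has_real_derivative \<phi>' t) (at t)) \<and>
    ((\<lambda>t. \<phi>' t / t) \<longlongrightarrow>
      s / N * (\<kappa> * partial2 \<psi> (E 0) * (\<Sum>j<N. (r j)\<^sup>2 * deriv U (s * x j)))) (at 0)"
proof -
  define \<phi>' where "\<phi>' t = partial1 \<psi> (E t) * (s / N * (\<Sum>j<N. x j * r j * deriv U (s * (x j +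
      t * r j)))) +
           partial2 \<psi> (E t) * (1 / N * (\<Sum>j<N. r j * deriv V (s * (x j + t * r j))))" for t
  define a where "a t = (\<Sum>j<N. x j * r j * deriv U (s * (x j + t * r j)))" for t
  define b where "b t = (\<Sum>j<N. (r j)\<^sup>2 * deriv U (s * (x j + t * r j)))" for t
  have ev_pos: "\<forall>\<^sub>F t in nhds 0. \<forall>j<N. 0 < x j + t * r j"
    using pos by (rule eventually_perturbation_pos)
  have E: "(E \<longlongrightarrow> E 0) (at 0)"
  proof -
    have "isCont (\<lambda>t. fst (E t)) 0" "isCont (\<lambda>t. snd (E t)) 0"
      unfolding E_def
      using step_moments_perturbed[OF U V N s, of x 0 r x] pos by (auto intro: DERIV_isCont)
    then show ?thesis
      using tendsto_Pair[of "\<lambda>t. fst (E t)" "fst (E 0)" "at 0" "\<lambda>t. snd (E t)" "snd (E 0)"]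
      by (simp add: isCont_def)
  qed
  then have "\<forall>\<^sub>F t in nhds 0. E t \<in> M"
    using topological_tendstoD[OF _ M(1) mem] tendsto_at_iff_tendsto_nhds by blast
  then have "\<forall>\<^sub>F t in nhds 0. ((\<lambda>t. \<psi> (E t)) has_real_derivative \<phi>' t) (at t)"
    using ev_pos
  proof eventually_elim
    case (elim t)
    then show ?case
      unfolding \<phi>'_def E_def by (intro score_perturbed[OF U V N s _ M]) auto
  qed
  moreover have "((\<lambda>t. \<phi>' t / t) \<longlongrightarrow> s / N * (\<kappa> * partial2 \<psi> (E 0) * b 0)) (at 0)"
  proof -
    have part: "((\<lambda>t. partial1 \<psi> (E t)) \<longlongrightarrow> partial1 \<psi> (E 0)) (at 0)" "((\<lambda>t. partial2 \<psi> (E t)) \<longlongrightarrow>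
        partial2 \<psi> (E 0)) (at 0)"
      using M mem E by (auto simp: C1_plane_def continuous_on_eq_continuous_at intro:
          isCont_tendsto_compose)
    have dU: "((\<lambda>t. deriv U (s * (x j + t * r j))) has_real_derivative
        deriv (deriv U) (s * x j) * (s * r j)) (at 0)"
      if "j < N" for j
      by (rule DERIV_chain2[where f = "deriv U"]) (use C2_pos_DERIV(2)[OF U, of "s * x j"]
          pos[OF that] s in \<open>auto intro!: derivative_eq_intros\<close>)
    have "(a has_real_derivative (\<Sum>j<N. x j * r j * (deriv (deriv U) (s * x j) * (s * r j)))) (at
        0)" (is "(_ has_real_derivative ?a') _")
      unfolding a_def by (intro DERIV_sum DERIV_cmult dU) auto
    moreover have "a 0 = 0" using crit by (simp add: a_def)
    ultimately have a: "((\<lambda>t. a t / t) \<longlongrightarrow> ?a') (at 0)"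
      by (simp add: has_field_derivative_iff)
    have b: "(b \<longlongrightarrow> b 0) (at 0)"
    proof -
      have "(b has_real_derivative (\<Sum>j<N. (r j)\<^sup>2 * (deriv (deriv U) (s * x j) * (s * r j)))) (at
          0)"
        unfolding b_def by (intro DERIV_sum DERIV_cmult dU) auto
      then show ?thesis using DERIV_isCont isCont_def by blast
    qed
    have "((\<lambda>t. s / N * ((partial1 \<psi> (E t) + \<kappa> * partial2 \<psi> (E t)) * (a t / t) + \<kappa> * partial2 \<psi> (E
        t) * b t))
        \<longlongrightarrow> s / N * ((partial1 \<psi> (E 0) + \<kappa> * partial2 \<psi> (E 0)) * ?a' + \<kappa> * partial2 \<psi> (E 0) * b 0))
            (at 0)"
      by (intro tendsto_intros part a b)
    moreover have "\<forall>\<^sub>F t in at 0. s / N * ((partial1 \<psi> (E t) + \<kappa> * partial2 \<psi> (E t)) * (a t / t) +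
        \<kappa> * partial2 \<psi> (E t) * b t) = \<phi>' t / t"
    proof -
      have "\<forall>\<^sub>F t in at 0. (\<forall>j<N. 0 < x j + t * r j) \<and> t \<noteq> 0"
        using ev_pos by (auto simp: eventually_at_filter elim: eventually_mono)
      then show ?thesis
      proof eventually_elim
        case (elim t)
        have "(\<Sum>j<N. r j * deriv V (s * (x j + t * r j))) = (\<Sum>j<N. \<kappa> * s * (x j * r j * deriv U (s
            * (x j + t * r j)) + t * ((r j)\<^sup>2 * deriv U (s * (x j + t * r j)))))"
        proof (intro sum.cong refl)
          fix j assume "j \<in> {..<N}"
          then have "s * (x j + t * r j) > 0" using elim s by simp
          from dV[OF this] show "r j * deriv V (s * (x j + t * r j)) =
              \<kappa> * s * (x j * r j * deriv U (s * (x j + t * r j)) + t * ((r j)\<^sup>2 * deriv U (s * (x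
              j + t * r j))))"
            by (simp only:) (simp add: power2_eq_square algebra_simps)
        qed
        also have "\<dots> = \<kappa> * s * (a t + t * b t)"
          by (simp only: a_def b_def sum.distrib sum_distrib_left[symmetric])
        finally show ?case
          using elim unfolding \<phi>'_def a_def[symmetric]
          by (simp add: divide_simps) (simp add: algebra_simps)
      qed
    qed
    ultimately show ?thesis
      using stat tendsto_cong by fastforce
  qed
  ultimately show ?thesis by (auto simp: b_def)
qed

text \<open>Invariance states that two functions of the perturbation parameter are proportional up to an
  additive constant near \<open>0\<close>, hence so are their derivatives, and dividing these by \<open>t\<close> compares
  the second variations before and after the dilation.\<close>

lemma invariant_second_variation:
  fixes x r :: "nat \<Rightarrow> real"
  assumes U: "C2_pos U" and V: "C2_pos V" and N: "N > 0" and s: "s > 0"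
    and pos: "\<And>j. j < N \<Longrightarrow> 0 < x j"
    and M: "open M" "C1_plane M \<psi>"
    and dV: "\<And>z. z > 0 \<Longrightarrow> deriv V z = \<kappa> * (z * deriv U z)"
    and inv: "\<And>y. (\<And>j. j < N \<Longrightarrow> 0 < y j) \<Longrightarrow> sum y {..<N} = sum x {..<N} \<Longrightarrow>
      h * (\<psi> (step_moments U V N s x y) - \<psi> (step_moments U V N s x x)) =
      \<psi> (step_moments U V N 1 x y) - \<psi> (step_moments U V N 1 x x)"
    and mem: "step_moments U V N 1 x x \<in> M" "step_moments U V N s x x \<in> M"
    and stat: "partial1 \<psi> (step_moments U V N 1 x x) + \<kappa> * partial2 \<psi> (step_moments U V N 1 x x) =
        0"
      "partial1 \<psi> (step_moments U V N s x x) + \<kappa> * partial2 \<psi> (step_moments U V N s x x) = 0"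
    and r: "sum r {..<N} = 0"
      "(\<Sum>j<N. x j * r j * deriv U (x j)) = 0" "(\<Sum>j<N. x j * r j * deriv U (s * x j)) = 0"
  shows "h * s * (\<kappa> * partial2 \<psi> (step_moments U V N s x x) * (\<Sum>j<N. (r j)\<^sup>2 * deriv U (s * x j))) =
    \<kappa> * partial2 \<psi> (step_moments U V N 1 x x) * (\<Sum>j<N. (r j)\<^sup>2 * deriv U (x j))" (is "h * s * ?c =
        ?d")
proof -
  let ?E = "\<lambda>s t. step_moments U V N s x (\<lambda>j. x j + t * r j)"
  obtain \<phi>s where s1: "\<forall>\<^sub>F t in nhds 0. ((\<lambda>t. \<psi> (?E s t)) has_real_derivative \<phi>s t) (at t)"
    and s2: "((\<lambda>t. \<phi>s t / t) \<longlongrightarrow> s / N * ?c) (at 0)"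
    using score_second_variation[OF U V N s, of x M \<psi> \<kappa> r] pos M dV mem(2) stat(2) r(3) by auto
  obtain \<phi> where t1: "\<forall>\<^sub>F t in nhds 0. ((\<lambda>t. \<psi> (?E 1 t)) has_real_derivative \<phi> t) (at t)"
    and t2: "((\<lambda>t. \<phi> t / t) \<longlongrightarrow> 1 / N * ?d) (at 0)"
    using score_second_variation[OF U V N zero_less_one, of x M \<psi> \<kappa> r] pos M dV mem(1) stat(1)
        r(2) by auto
  have ev_pos: "\<forall>\<^sub>F t in nhds 0. \<forall>j<N. 0 < x j + t * r j"
    using pos by (rule eventually_perturbation_pos)
  then have "\<forall>\<^sub>F t in nhds 0. h * (\<psi> (?E s t) - \<psi> (?E s 0)) = \<psi> (?E 1 t) - \<psi> (?E 1 0)"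
  proof eventually_elim
    case (elim t)
    then show ?case
      using inv[of "\<lambda>j. x j + t * r j"] r(1) by (simp add: sum.distrib sum_distrib_left[symmetric])
  qed
  \<comment> \<open>The equality must hold near each such \<open>t\<close> to pass to derivatives at \<open>t\<close>.\<close>
  then have "\<forall>\<^sub>F t in nhds 0. \<forall>\<^sub>F t in nhds t. h * (\<psi> (?E s t) - \<psi> (?E s 0)) =
      \<psi> (?E 1 t) - \<psi> (?E 1 0)"
    by (simp add: eventually_eventually)
  then have "\<forall>\<^sub>F t in nhds 0. h * \<phi>s t = \<phi> t"
    using s1 t1
  proof eventually_elim
    case (elim t)
    have "((\<lambda>t. h * (\<psi> (?E s t) - \<psi> (?E s 0))) has_real_derivative h * (\<phi>s t - 0)) (at t)"
      by (intro DERIV_cmult DERIV_diff elim DERIV_const)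
    moreover have "((\<lambda>t. \<psi> (?E 1 t) - \<psi> (?E 1 0)) has_real_derivative \<phi> t - 0) (at t)"
      by (intro DERIV_diff elim DERIV_const)
    ultimately show ?case
      using DERIV_cong_ev[OF refl elim(1) refl] DERIV_unique by fastforce
  qed
  then have "\<forall>\<^sub>F t in at 0. h * (\<phi>s t / t) = \<phi> t / t"
    by (auto simp: eventually_at_filter elim: eventually_mono)
  moreover have "((\<lambda>t. h * (\<phi>s t / t)) \<longlongrightarrow> h * (s / N * ?c)) (at 0)"
    by (intro tendsto_intros s2)
  ultimately have "((\<lambda>t. \<phi> t / t) \<longlongrightarrow> h * (s / N * ?c)) (at 0)"
    using tendsto_cong by fast
  then have "h * (s / N * ?c) = 1 / N * ?d"
    using t2 tendsto_unique[OF at_neq_bot] by blast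
  then show ?thesis using N by (simp add: field_simps)
qed

section \<open>Invariance determines the derivative of the first function\<close>

definition mass_transfer :: "nat \<Rightarrow> nat \<Rightarrow> nat \<Rightarrow> real" where
  "mass_transfer i k j = (if j = i then 1 else if j = k then -1 else 0)"

lemma sum_mass_transfer:
  assumes "i < N" and "k < N" and "i \<noteq> k"
  shows "(\<Sum>j<N. mass_transfer i k j * g j) = g i - g k"
    and "(\<Sum>j<N. (mass_transfer i k j)\<^sup>2 * g j) = g i + g k"
proof -
  have 1: "mass_transfer i k j * g j = (if j = i then g j else 0) - (if j = k then g j else 0)"
    and 2: "(mass_transfer i k j)\<^sup>2 * g j =
      (if j = i then g j else 0) + (if j = k then g j else 0)" for j
    using assms(3) by (auto simp: mass_transfer_def)
  show "(\<Sum>j<N. mass_transfer i k j * g j) = g i - g k"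
    "(\<Sum>j<N. (mass_transfer i k j)\<^sup>2 * g j) = g i + g k"
    unfolding 1 2 using assms by (simp_all add: sum_subtractf sum.distrib)
qed

text \<open>Each of \<open>z1\<close> and \<open>z2\<close> occurs twice, so that mass can be moved between two slabs of equal
  value, a direction in which every first-order quantity vanishes. The values \<open>z3\<close> and \<open>z4\<close> occur
  once and serve for a direction with nonzero first variation. All further slabs share one value
  that restores the mean \<open>1\<close>, which is positive when there are sufficiently many slabs.\<close>

lemma exists_values_with_mean_one:
  fixes z1 z2 z3 z4 :: real
  assumes "z1 > 0" "z2 > 0" "z3 > 0" "z4 > 0"
  obtains N and x :: "nat \<Rightarrow> real" where "N > 6" and "\<forall>j. 0 < x j" and "sum x {..<N} = real N"
    and "x 0 = z1" "x 1 = z1" "x 2 = z2" "x 3 = z2" "x 4 = z3" "x 5 = z4"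
proof -
  define S where "S = 2 * z1 + 2 * z2 + z3 + z4"
  obtain m :: nat where m: "real m > S" using reals_Archimedean2 by blast
  define N where "N = m + 7"
  define w where "w = (real N - S) / real (N - 6)"
  define x where "x j = (if j < 2 then z1 else if j < 4 then z2
      else if j = 4 then z3 else if j = 5 then z4 else w)" for j :: nat
  have w: "w > 0" using m by (simp add: w_def N_def)
  have "sum x {..<N} = sum x {..<6} + sum x {6..<N}"
    using sum.atLeastLessThan_concat[of 0 6 N x] by (simp add: N_def lessThan_atLeast0)
  also have "sum x {6..<N} = (\<Sum>j = 6..<N. w)"
    by (intro sum.cong) (auto simp: x_def)
  also have "sum x {..<6} = S"
    by (simp add: eval_nat_numeral x_def S_def)
  also have "S + (\<Sum>j = 6..<N. w) = real N"
    by (simp add: w_def N_def)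
  finally show ?thesis
    using that[of N x] assms w by (simp add: N_def x_def)
qed

text \<open>The core of the argument: near \<open>s = 1\<close> the vectors \<open>(U' (s z1), U' (s z2))\<close> and
  \<open>(U' z1, U' z2)\<close> are parallel. A density with values \<open>z1, z1, z2, z2, z3, z4, \<dots>\<close> is perturbed by
  moving mass between the two slabs of value \<open>z1\<close>, and likewise for \<open>z2\<close>. The second variations
  are multiples of \<open>U' (s z1)\<close> and \<open>U' (s z2)\<close> with a common factor, and for \<open>s = 1\<close> this factor
  is not zero.

  Both applications of the second variation require \<open>\<psi>\<^sub>1 + \<kappa> \<psi>\<^sub>2 = 0\<close> at the dilated density.
  Propriety gives this directly for \<open>s = 1\<close> only, because it compares undilated densities. But by
  invariance the divergence of dilated densities is minimal on the diagonal, and moving mass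
  between the slabs with values \<open>z3\<close> and \<open>z4\<close> turns this into the desired equation whenever
  \<open>z3 U' (s z3) \<noteq> z4 U' (s z4)\<close>. For \<open>s\<close> close to \<open>1\<close> the last inequality persists and the dilated
  moments remain where \<open>\<psi>\<close> is smooth.\<close>

lemma invariance_imp_ratio:
  assumes U: "C2_pos U" and V: "C2_pos V"
    and dV: "\<And>z. z > 0 \<Longrightarrow> deriv V z = \<kappa> * (z * deriv U z)" and \<kappa>: "\<kappa> \<noteq> 0"
    and proper: "\<And>N x y. N > 0 \<Longrightarrow> (\<And>j. j < N \<Longrightarrow> 0 < x j) \<Longrightarrow> (\<And>j. j < N \<Longrightarrow> 0 < y j) \<Longrightarrow>
      \<psi> (step_moments U V N 1 x x) \<le> \<psi> (step_moments U V N 1 x y)"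
    and reg: "\<And>N x. N > 0 \<Longrightarrow> (\<And>j. j < N \<Longrightarrow> 0 < x j) \<Longrightarrow>
      \<exists>M. open M \<and> step_moments U V N 1 x x \<in> M \<and> C1_plane M \<psi> \<and>
        (\<forall>y\<in>M. (partial1 \<psi> y, partial2 \<psi> y) \<noteq> (0, 0))"
    and inv: "\<And>s. s > 0 \<Longrightarrow> \<exists>h>0. \<forall>N x y. N > 0 \<longrightarrow> (\<forall>j<N. 0 < x j) \<longrightarrow> (\<forall>j<N. 0 < y j) \<longrightarrow>
      sum x {..<N} = real N \<longrightarrow> sum y {..<N} = real N \<longrightarrow>
      h * (\<psi> (step_moments U V N s x y) - \<psi> (step_moments U V N s x x)) =
      \<psi> (step_moments U V N 1 x y) - \<psi> (step_moments U V N 1 x x)"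
    and z: "z1 > 0" "z2 > 0" "z3 > 0" "z4 > 0" and nonconst: "z3 * deriv U z3 \<noteq> z4 * deriv U z4"
  shows "\<forall>\<^sub>F s in nhds 1. deriv U z1 * deriv U (s * z2) = deriv U z2 * deriv U (s * z1)"
proof -
  obtain N and x :: "nat \<Rightarrow> real" where N: "N > 6" and pos': "\<forall>j. 0 < x j" and sum: "sum x {..<N} =
      real N"
    and x: "x 0 = z1" "x 1 = z1" "x 2 = z2" "x 3 = z2" "x 4 = z3" "x 5 = z4"
    using exists_values_with_mean_one[OF z] .
  have N0: "N > 0" using N by simp
  have pos: "0 < x j" for j using pos' by simp
  obtain M where M: "open M" "step_moments U V N 1 x x \<in> M" "C1_plane M \<psi>"
    and grad: "\<forall>y\<in>M. (partial1 \<psi> y, partial2 \<psi> y) \<noteq> (0, 0)"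
    using reg[OF N0, of x] pos by auto
  let ?E = "\<lambda>s. step_moments U V N s x x"
  let ?g = "\<lambda>s z. z * deriv U (s * z)"
  have stat: "partial1 \<psi> (?E s) + \<kappa> * partial2 \<psi> (?E s) = 0"
    if s: "s > 0" "?E s \<in> M" "?g s z3 \<noteq> ?g s z4" for s
  proof -
    obtain h where h: "h > 0" and h0: "\<forall>N x y. N > 0 \<longrightarrow> (\<forall>j<N. 0 < x j) \<longrightarrow> (\<forall>j<N. 0 < y j) \<longrightarrow>
      sum x {..<N} = real N \<longrightarrow> sum y {..<N} = real N \<longrightarrow>
      h * (\<psi> (step_moments U V N s x y) - \<psi> (step_moments U V N s x x)) =
      \<psi> (step_moments U V N 1 x y) - \<psi> (step_moments U V N 1 x x)"
      using inv[OF s(1)] by blast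
    have hinv: "h * (\<psi> (step_moments U V N s x y) - \<psi> (?E s)) =
        \<psi> (step_moments U V N 1 x y) - \<psi> (?E 1)"
      if "\<And>j. j < N \<Longrightarrow> 0 < y j" "sum y {..<N} = real N" for y
      using h0[rule_format, of N x y] N0 pos sum that by simp
    let ?r = "mass_transfer 4 5"
    have sum_r: "sum ?r {..<N} = 0" using sum_mass_transfer(1)[of 4 N 5 "\<lambda>_. 1"] N by simp
    have min: "\<psi> (?E s) \<le> \<psi> (step_moments U V N s x (\<lambda>j. x j + t * ?r j))"
        if "\<And>j. j < N \<Longrightarrow> 0 < x j + t * ?r j" for t
    proof -
      have "sum (\<lambda>j. x j + t * ?r j) {..<N} = real N"
        using sum sum_r by (simp add: sum.distrib sum_distrib_left[symmetric])
      then have "h * (\<psi> (step_moments U V N s x (\<lambda>j. x j + t * ?r j)) - \<psi> (?E s)) =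
         \<psi> (step_moments U V N 1 x (\<lambda>j. x j + t * ?r j)) - \<psi> (?E 1)"
        using that by (intro hinv)
      moreover have "\<psi> (?E 1) \<le> \<psi> (step_moments U V N 1 x (\<lambda>j. x j + t * ?r j))"
        using pos that by (intro proper[OF N0])
      ultimately show ?thesis using h by (smt (verit) mult_pos_neg)
    qed
    have "s * partial1 \<psi> (?E s) * (\<Sum>j<N. x j * ?r j * deriv U (s * x j)) +
         partial2 \<psi> (?E s) * (\<Sum>j<N. ?r j * deriv V (s * x j)) = 0"
      by (rule optimality_condition[OF U V N0 s(1) _ M(1,3) s(2)]) (auto intro: pos min)
    moreover have "(\<Sum>j<N. x j * ?r j * deriv U (s * x j)) = ?g s z3 - ?g s z4"
      using sum_mass_transfer(1)[of 4 N 5 "\<lambda>j. x j * deriv U (s * x j)"] N x by (simp add: mult_ac)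
    moreover have "(\<Sum>j<N. ?r j * deriv V (s * x j)) = \<kappa> * s * (?g s z3 - ?g s z4)"
      using sum_mass_transfer(1)[of 4 N 5 "\<lambda>j. deriv V (s * x j)"] N x z s(1) dV[of "s * z3"]
          dV[of "s * z4"]
      by (simp add: algebra_simps)
    ultimately have "s * (?g s z3 - ?g s z4) * (partial1 \<psi> (?E s) + \<kappa> * partial2 \<psi> (?E s)) = 0"
      by algebra
    then show ?thesis using s by simp
  qed
  have ratio: "deriv U z1 * deriv U (s * z2) = deriv U z2 * deriv U (s * z1)"
    if s: "s > 0" "?E s \<in> M" "?g s z3 \<noteq> ?g s z4" for s
  proof -
    obtain h where h: "h > 0" and h0: "\<forall>N x y. N > 0 \<longrightarrow> (\<forall>j<N. 0 < x j) \<longrightarrow> (\<forall>j<N. 0 < y j) \<longrightarrow>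
      sum x {..<N} = real N \<longrightarrow> sum y {..<N} = real N \<longrightarrow>
      h * (\<psi> (step_moments U V N s x y) - \<psi> (step_moments U V N s x x)) =
      \<psi> (step_moments U V N 1 x y) - \<psi> (step_moments U V N 1 x x)"
      using inv[OF s(1)] by blast
    have hinv: "h * (\<psi> (step_moments U V N s x y) - \<psi> (?E s)) =
        \<psi> (step_moments U V N 1 x y) - \<psi> (?E 1)"
      if "\<And>j. j < N \<Longrightarrow> 0 < y j" "sum y {..<N} = real N" for y
      using h0[rule_format, of N x y] N0 pos sum that by simp
    define c d where "c = 2 * (h * s * (\<kappa> * partial2 \<psi> (?E s)))"
        and "d = 2 * (\<kappa> * partial2 \<psi> (?E 1))"
    have stat1: "partial1 \<psi> (?E 1) + \<kappa> * partial2 \<psi> (?E 1) = 0"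
      using stat[of 1] M(2) nonconst by simp
    have "partial2 \<psi> (?E 1) \<noteq> 0" using stat1 grad M(2) by fastforce
    then have d: "d \<noteq> 0" using \<kappa> by (simp add: d_def)
    have var: "c * deriv U (s * x i) = d * deriv U (x i)" if i: "Suc i < N" "x (Suc i) = x i" for i
    proof -
      \<comment> \<open>Both slabs have the same value, so the first variation vanishes for every dilation \<open>u\<close>.\<close>
      let ?r = "mass_transfer i (Suc i)"
      have crit: "(\<Sum>j<N. x j * ?r j * deriv U (u * x j)) = 0" for u
        using sum_mass_transfer(1)[of i N "Suc i" "\<lambda>j. x j * deriv U (u * x j)"] i
            by (simp add: mult_ac)
      have sq: "(\<Sum>j<N. (?r j)\<^sup>2 * deriv U (u * x j)) = 2 * deriv U (u * x i)" for u
        using sum_mass_transfer(2)[of i N "Suc i" "\<lambda>j. deriv U (u * x j)"] i by simp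
      have sum_r: "sum ?r {..<N} = 0" using sum_mass_transfer(1)[of i N "Suc i" "\<lambda>_. 1"] i by simp
      have "h * s * (\<kappa> * partial2 \<psi> (?E s) * (\<Sum>j<N. (?r j)\<^sup>2 * deriv U (s * x j))) =
          \<kappa> * partial2 \<psi> (?E 1) * (\<Sum>j<N. (?r j)\<^sup>2 * deriv U (x j))"
        using hinv sum crit[of 1] stat1
        by (intro invariant_second_variation[OF U V N0 s(1) pos M(1,3) dV _ M(2) s(2) _ stat[OF s]
            sum_r _ crit]) auto
      then show ?thesis using sq[of s] sq[of 1] by (simp add: c_def d_def mult_ac)
    qed
    have "c * deriv U (s * z1) = d * deriv U z1" "c * deriv U (s * z2) = d * deriv U z2"
      using var[of 0] var[of 2] N x by (simp_all add: eval_nat_numeral)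
    then have "d * (deriv U z1 * deriv U (s * z2)) = d * (deriv U z2 * deriv U (s * z1))"
      by algebra
    then show ?thesis using d by simp
  qed
  have cont: "isCont (\<lambda>s. f (s * y)) 1" if "isCont f y" for f :: "real \<Rightarrow> real" and y
    by (rule isCont_o2[where g = f]) (use that in \<open>auto intro!: continuous_intros\<close>)
  have "\<forall>\<^sub>F s in nhds 1. ?E s \<in> M"
  proof -
    have "isCont (\<lambda>s. (\<Sum>j<N. x j * U (s * x j)) / real N) 1" "isCont (\<lambda>s. (\<Sum>j<N. V (s * x j)) /
        (real N * s)) 1"
      using N0 DERIV_isCont[OF C2_pos_DERIV(1)[OF U pos]] DERIV_isCont[OF C2_pos_DERIV(1)[OF V pos]]
      by (auto intro!: continuous_intros cont)
    then have "isCont ?E 1"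
      unfolding step_moments_def by (rule continuous_Pair)
    then have "(?E \<longlongrightarrow> ?E 1) (nhds 1)"
      using tendsto_at_iff_tendsto_nhds[of ?E 1] unfolding isCont_def by blast
    then show ?thesis
      using M(1,2) by (rule topological_tendstoD)
  qed
  moreover have "\<forall>\<^sub>F s in nhds 1. ?g s z3 - ?g s z4 \<noteq> 0"
  proof -
    have "isCont (\<lambda>s. ?g s z3 - ?g s z4) 1"
      using C2_pos_DERIV(2)[OF U z(3)] C2_pos_DERIV(2)[OF U z(4)]
      by (intro continuous_intros cont) (auto intro: DERIV_isCont)
    then have "((\<lambda>s. ?g s z3 - ?g s z4) \<longlongrightarrow> ?g 1 z3 - ?g 1 z4) (nhds 1)"
      using tendsto_at_iff_tendsto_nhds[of "\<lambda>s. ?g s z3 - ?g s z4" 1] unfolding isCont_def by blast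
    then show ?thesis
      using nonconst by (intro tendsto_imp_eventually_ne) auto
  qed
  moreover have "\<forall>\<^sub>F s in nhds (1::real). s > 0"
    by (intro eventually_nhds_in_open[of "{0<..}", simplified]) auto
  ultimately show ?thesis
  proof eventually_elim
    case (elim s)
    show ?case using elim by (intro ratio) simp_all
  qed
qed

text \<open>Differentiating the relation at \<open>s = 1\<close> shows that \<open>z U'' z\<close> is proportional to \<open>U' z\<close> with
  a factor \<open>\<beta>\<close> independent of \<open>z\<close>. This is Euler's equation for functions homogeneous of degree
  \<open>\<beta>\<close>, and \<open>U' z * z powr (-\<beta>)\<close> has derivative zero.\<close>

lemma constant_ratio_imp_power:
  assumes U: "C2_pos U" and nonconst: "\<not> U constant_on {0<..}"
    and ratio: "\<And>z1 z2. z1 > 0 \<Longrightarrow> z2 > 0 \<Longrightarrow>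
      \<forall>\<^sub>F s in nhds 1. deriv U z1 * deriv U (s * z2) = deriv U z2 * deriv U (s * z1)"
  obtains a \<beta> where "a \<noteq> 0" and "\<And>z. z > 0 \<Longrightarrow> deriv U z = a * z powr \<beta>"
proof -
  let ?U2 = "deriv (deriv U)"
  have euler: "deriv U z1 * (z2 * ?U2 z2) = deriv U z2 * (z1 * ?U2 z1)" if z: "z1 > 0" "z2 > 0"
      for z1 z2
  proof -
    have d: "((\<lambda>s. deriv U (s * z)) has_real_derivative ?U2 z * z) (at 1)" if "z > 0" for z
      by (rule DERIV_chain2[where f = "deriv U"]) (use C2_pos_DERIV(2)[OF U that] in \<open>auto intro!:
          derivative_eq_intros\<close>)
    have "deriv U z1 * (?U2 z2 * z2) = deriv U z2 * (?U2 z1 * z1)"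
      using DERIV_cong_ev[OF refl ratio[OF z] refl] DERIV_cmult[OF d[OF z(2)], of "deriv U z1"]
          DERIV_cmult[OF d[OF z(1)], of "deriv U z2"]
        DERIV_unique by blast
    then show ?thesis by (simp add: mult_ac)
  qed
  obtain z0 where z0: "z0 > 0" "deriv U z0 \<noteq> 0" using nonconstant_deriv[OF U nonconst] .
  define \<beta> where "\<beta> = z0 * ?U2 z0 / deriv U z0"
  have ode: "z * ?U2 z = \<beta> * deriv U z" if "z > 0" for z
    using euler[OF z0(1) that] z0(2) by (simp add: \<beta>_def field_simps)
  have "\<exists>a. \<forall>z\<in>{0<..}. deriv U z * z powr (-\<beta>) = a"
  proof (rule has_field_derivative_zero_constant)
    fix z :: real assume "z \<in> {0<..}"
    then have z: "z > 0" by simp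
    have "((\<lambda>z. deriv U z * z powr (-\<beta>)) has_real_derivative
        (?U2 z * z powr (-\<beta>) + (-\<beta> * z powr (-\<beta> - 1)) * deriv U z)) (at z)"
      by (intro DERIV_mult C2_pos_DERIV(2)[OF U z] has_real_derivative_powr z)
    moreover have "?U2 z * z powr (-\<beta>) + (-\<beta> * z powr (-\<beta> - 1)) * deriv U z =
        (z * ?U2 z - \<beta> * deriv U z) * z powr (-\<beta> - 1)"
      using z by (simp add: powr_diff field_simps)
    ultimately show "((\<lambda>z. deriv U z * z powr (-\<beta>)) has_real_derivative 0) (at z within {0<..})"
      using ode[OF z] by (simp add: has_field_derivative_at_within)
  qed (rule convex_real_interval)
  then obtain a where a: "\<And>z. z > 0 \<Longrightarrow> deriv U z * z powr (-\<beta>) = a" by auto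
  have "deriv U z = a * z powr \<beta>" if "z > 0" for z
    using a[OF that] that by (simp add: powr_minus field_simps)
  moreover have "a \<noteq> 0" using a[OF z0(1)] z0 by auto
  ultimately show ?thesis using that by blast
qed

section \<open>Integration\<close>

lemma eq_up_to_constant:
  fixes f g :: "real \<Rightarrow> real"
  assumes "\<And>z. z > 0 \<Longrightarrow> (f has_real_derivative d z) (at z)" and "\<And>z. z > 0 \<Longrightarrow> (g has_real_derivative
      d z) (at z)"
  obtains c where "\<And>z. z > 0 \<Longrightarrow> f z = g z + c"
proof -
  have "\<exists>c. \<forall>z\<in>{0<..}. f z - g z = c"
  proof (rule has_field_derivative_zero_constant)
    fix z :: real assume "z \<in> {0<..}"
    then have "((\<lambda>z. f z - g z) has_real_derivative d z - d z) (at z)"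
      by (intro DERIV_diff assms) auto
    then show "((\<lambda>z. f z - g z) has_real_derivative 0) (at z within {0<..})"
      by (simp add: has_field_derivative_at_within)
  qed (rule convex_real_interval)
  then obtain c where "\<And>z. z > 0 \<Longrightarrow> f z - g z = c" by auto
  then show ?thesis using that[of c] by (metis add.commute diff_add_cancel)
qed

text \<open>The behaviour of \<open>V\<close> at \<open>0\<close> selects the solutions. As \<open>V' z\<close> is a nonzero multiple of
  \<open>z powr \<gamma>\<close> for \<open>\<gamma> = \<beta> + 1\<close>, a finite limit of \<open>V'\<close> excludes \<open>\<gamma> < 0\<close>; and \<open>V \<longlongrightarrow> 0\<close> forces the
  integration constant of \<open>V\<close> to be \<open>0\<close>. The borderline \<open>\<gamma> = 0\<close> is the logarithmic case.\<close>

lemma integrate_power_solution: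
  assumes U: "C2_pos U" and V: "C2_pos V"
    and a: "a \<noteq> 0" and dU: "\<And>z. z > 0 \<Longrightarrow> deriv U z = a * z powr \<beta>"
    and \<kappa>: "\<kappa> \<noteq> 0" and dV: "\<And>z. z > 0 \<Longrightarrow> deriv V z = \<kappa> * (z * deriv U z)"
    and V0: "(V \<longlongrightarrow> 0) (at_right 0)" and dV0: "(deriv V \<longlongrightarrow> L) (at_right 0)"
  shows "\<exists>a b :: real. a \<noteq> 0 \<and> b \<noteq> 0 \<and>
           ((\<exists>\<gamma> c :: real. \<gamma> > 0 \<and>
               (\<forall>z>0. U z = a * (z powr \<gamma> + c) \<and> V z = b * z powr (1 + \<gamma>))) \<or>
            (\<exists>c :: real. \<forall>z>0. U z = a * (- ln z + c) \<and> V z = b * z))"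
proof -
  define \<gamma> where "\<gamma> = \<beta> + 1"
  have dU': "(U has_real_derivative a * z powr (\<gamma> - 1)) (at z)" if "z > 0" for z
    using C2_pos_DERIV(1)[OF U that] dU[OF that] by (simp add: \<gamma>_def)
  have dV': "(V has_real_derivative \<kappa> * a * z powr \<gamma>) (at z)" "deriv V z = \<kappa> * a * z powr \<gamma>"
      if "z > 0" for z
    using C2_pos_DERIV(1)[OF V that] dV[OF that] dU[OF that] that
        by (simp_all add: \<gamma>_def powr_add mult_ac)
  have at0: "\<forall>\<^sub>F z in at_right 0. z > (0::real)" by (simp add: eventually_at_right_less)
  have \<gamma>0: "\<gamma> \<ge> 0"
  proof (rule ccontr)
    assume "\<not> \<gamma> \<ge> 0"
    then have neg: "\<gamma> < 0" by simp
    have "((\<lambda>z. deriv V z / (\<kappa> * a)) \<longlongrightarrow> L / (\<kappa> * a)) (at_right 0)"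
      using a \<kappa> by (intro tendsto_intros dV0) auto
    then have "((\<lambda>z. z powr \<gamma>) \<longlongrightarrow> L / (\<kappa> * a)) (at_right 0)"
      by (rule Lim_transform_eventually) (use at0 in \<open>auto elim!: eventually_mono simp: dV'(2) a \<kappa>\<close>)
    \<comment> \<open>A finite limit of \<open>z powr \<gamma>\<close> would make the constant \<open>1\<close> tend to \<open>0\<close>.\<close>
    moreover have "((\<lambda>z::real. z powr (- \<gamma>)) \<longlongrightarrow> 0) (at_right 0)"
      using neg by (intro tendsto_zero_powrI[where b = "- \<gamma>"] tendsto_ident_at tendsto_const)
          (auto simp: at0 eventually_mono[OF at0])
    ultimately have "((\<lambda>z::real. z powr \<gamma> * z powr (- \<gamma>)) \<longlongrightarrow> L / (\<kappa> * a) * 0) (at_right 0)"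
      by (rule tendsto_mult)
    then have "((\<lambda>z::real. 1) \<longlongrightarrow> L / (\<kappa> * a) * 0) (at_right 0)"
      by (rule Lim_transform_eventually) (use at0 in \<open>auto elim!: eventually_mono simp: powr_minus\<close>)
    then show False
      using tendsto_unique[OF trivial_limit_at_right_real _ tendsto_const] by fastforce
  qed
  have "((\<lambda>z. \<kappa> * a / (\<gamma> + 1) * z powr (\<gamma> + 1)) has_real_derivative \<kappa> * a * z powr \<gamma>) (at z)"
      if "z > 0" for z
    using DERIV_cmult[OF has_real_derivative_powr[OF that, of "\<gamma> + 1"], of "\<kappa> * a / (\<gamma> + 1)"] \<gamma>0
        by (simp add: mult.assoc)
  then obtain e where e: "\<And>z. z > 0 \<Longrightarrow> V z = \<kappa> * a / (\<gamma> + 1) * z powr (\<gamma> + 1) + e"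
    using eq_up_to_constant[OF dV'(1), of "\<lambda>z. \<kappa> * a / (\<gamma> + 1) * z powr (\<gamma> + 1)"] by blast
  have "((\<lambda>z::real. z powr (\<gamma> + 1)) \<longlongrightarrow> 0) (at_right 0)"
    using \<gamma>0 by (intro tendsto_zero_powrI[where b = "\<gamma> + 1"] tendsto_ident_at tendsto_const) (auto
        simp: eventually_mono[OF at0])
  then have "((\<lambda>z. \<kappa> * a / (\<gamma> + 1) * z powr (\<gamma> + 1) + e) \<longlongrightarrow> \<kappa> * a / (\<gamma> + 1) * 0 + e) (at_right 0)"
    by (intro tendsto_intros)
  then have "(V \<longlongrightarrow> \<kappa> * a / (\<gamma> + 1) * 0 + e) (at_right 0)"
    by (rule Lim_transform_eventually) (use at0 in \<open>auto elim!: eventually_mono simp: e\<close>)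
  then have "\<kappa> * a / (\<gamma> + 1) * 0 + e = 0"
    using V0 tendsto_unique[OF trivial_limit_at_right_real] by blast
  then have "e = 0" by simp
  then have V_eq: "V z = \<kappa> * a / (\<gamma> + 1) * z powr (1 + \<gamma>)" if "z > 0" for z
    using e[OF that] by (simp add: add.commute)
  show ?thesis
  proof (cases "\<gamma> = 0")
    case True
    have "((\<lambda>z. a * ln z) has_real_derivative a * z powr (\<gamma> - 1)) (at z)" if "z > 0" for z
      using that DERIV_cmult[OF DERIV_ln[OF that], of a] by (simp add: True powr_minus)
    then obtain c where "\<And>z. z > 0 \<Longrightarrow> U z = a * ln z + c"
      using eq_up_to_constant[OF dU'] by blast
    then have "\<forall>z>0. U z = - a * (- ln z + (- c / a)) \<and> V z = \<kappa> * a * z"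
      using a V_eq True by (simp add: field_simps)
    then show ?thesis using a \<kappa>
      by (intro exI[of _ "-a"] exI[of _ "\<kappa> * a"] conjI disjI2 exI[of _ "- c / a"]) auto
  next
    case False
    then have \<gamma>: "\<gamma> > 0" using \<gamma>0 by simp
    have "((\<lambda>z. a / \<gamma> * z powr \<gamma>) has_real_derivative a * z powr (\<gamma> - 1)) (at z)" if "z > 0" for z
      using that DERIV_cmult[OF has_real_derivative_powr[OF that, of \<gamma>], of "a / \<gamma>"] \<gamma> by simp
    then obtain c where c: "\<And>z. z > 0 \<Longrightarrow> U z = a / \<gamma> * z powr \<gamma> + c"
      using eq_up_to_constant[OF dU'] by blast
    have "\<forall>z>0. U z = a / \<gamma> * (z powr \<gamma> + c * \<gamma> / a) \<and> V z = \<kappa> * a / (\<gamma> + 1) * z powr (1 + \<gamma>)"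
      using a \<gamma> by (auto simp: c V_eq distrib_left)
    then show ?thesis using a \<kappa> \<gamma>
      by (intro exI[of _ "a / \<gamma>"] exI[of _ "\<kappa> * a / (\<gamma> + 1)"] conjI disjI1 exI[of _ \<gamma>]
          exI[of _ "c * \<gamma> / a"]) auto
  qed
qed

section \<open>Affine invariant composite scores\<close>

theorem theorem3:
  fixes F :: "('n::finite) rvfun set"
    and S :: "'n rvfun \<Rightarrow> 'n rvfun \<Rightarrow> real"
    and U V :: "real \<Rightarrow> real"
    and \<psi> :: "real \<times> real \<Rightarrow> real"
    and \<Psi> :: "(real \<times> real) set"
  assumes "convex_funs F"
    and "F_zero \<subseteq> F" and "F \<subseteq> L0_plus"
    and "composite_score F S"
    and "\<And>f g. f \<in> F \<Longrightarrow> g \<in> F \<Longrightarrow> S f g = formula_score U V \<psi> f g"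
    and "\<And>f g. f \<in> F \<Longrightarrow> g \<in> F \<Longrightarrow> moments_integrable U V f g"
    and "C2_pos U" and "C2_pos V"
    and "\<not> U constant_on {0<..}" and "\<not> V constant_on {0<..}"
    and "(V \<longlongrightarrow> 0) (at_right 0)" and "V 0 = 0"
    and "\<exists>L. (deriv V \<longlongrightarrow> L) (at_right 0)"
    and "\<And>x. x \<in> D_set F U V \<Longrightarrow> \<exists>N. open N \<and> x \<in> N \<and> N \<subseteq> \<Psi> \<and> C2_plane N \<psi>"
    and "\<And>x. x \<in> E_set F U V \<Longrightarrow>
           \<exists>N. open N \<and> x \<in> N \<and> N \<subseteq> \<Psi> \<and> (\<forall>y\<in>N. (partial1 \<psi> y, partial2 \<psi> y) \<noteq> (0, 0))"
    and "affine_invariant_divergence F S U V \<Psi> \<psi>"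
  shows "\<exists>a b :: real. a \<noteq> 0 \<and> b \<noteq> 0 \<and>
           ((\<exists>\<gamma> c :: real. \<gamma> > 0 \<and>
               (\<forall>z>0. U z = a * (z powr \<gamma> + c) \<and> V z = b * z powr (1 + \<gamma>))) \<or>
            (\<exists>c :: real. \<forall>z>0. U z = a * (- ln z + c) \<and> V z = b * z))"
proof -
  let ?k = "undefined :: 'n"
  let ?f = "\<lambda>N x. step_density N ?k x"
  have inF: "?f N x \<in> F" if "N > 0" "\<And>j. j < N \<Longrightarrow> 0 < x j" for N x
    using step_density_in_F_zero[of N x ?k] that assms(2) by blast
  have mom: "moments U V (?f N x) (?f N y) = step_moments U V N 1 x y" if "N > 0" for N x y
    using that assms(12) by (intro moments_step_density)
  have score: "S (?f N x) (?f N y) = \<psi> (step_moments U V N 1 x y)"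
    if "N > 0" "\<And>j. j < N \<Longrightarrow> 0 < x j" "\<And>j. j < N \<Longrightarrow> 0 < y j" for N x y
    using assms(5)[OF inF inF] that mom by (simp add: formula_score_def)
  have proper: "\<psi> (step_moments U V N 1 x x) \<le> \<psi> (step_moments U V N 1 x y)"
    if "N > 0" "\<And>j. j < N \<Longrightarrow> 0 < x j" "\<And>j. j < N \<Longrightarrow> 0 < y j" for N x y
  proof -
    have "S (?f N x) (?f N x) \<le> S (?f N x) (?f N y)"
      using assms(4) inF that unfolding composite_score_def by blast
    then show ?thesis using score that by simp
  qed
  have reg: "\<exists>M. open M \<and> step_moments U V N 1 x x \<in> M \<and> C1_plane M \<psi> \<and>
        (\<forall>y\<in>M. (partial1 \<psi> y, partial2 \<psi> y) \<noteq> (0, 0))"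
    if "N > 0" "\<And>j. j < N \<Longrightarrow> 0 < x j" for N x
  proof -
    let ?p = "step_moments U V N 1 x x"
    have "?p \<in> D_set F U V" "?p \<in> E_set F U V"
      using mom[OF that(1), of x x, symmetric] inF[of N x] that unfolding D_set_def E_set_def
          by blast+
    then obtain M1 M2 where "open M1" "?p \<in> M1" "C2_plane M1 \<psi>"
      and "open M2" "?p \<in> M2" "\<forall>y\<in>M2. (partial1 \<psi> y, partial2 \<psi> y) \<noteq> (0, 0)"
      using assms(14,15) by metis
    moreover from this have "C1_plane (M1 \<inter> M2) \<psi>"
      by (auto simp: C2_plane_def C1_plane_def intro: continuous_on_subset)
    ultimately show ?thesis
      by (intro exI[of _ "M1 \<inter> M2"]) auto
  qed
  have inv: "\<exists>h>0. \<forall>N x y. N > 0 \<longrightarrow> (\<forall>j<N. 0 < x j) \<longrightarrow> (\<forall>j<N. 0 < y j) \<longrightarrow>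
      sum x {..<N} = real N \<longrightarrow> sum y {..<N} = real N \<longrightarrow>
      h * (\<psi> (step_moments U V N s x y) - \<psi> (step_moments U V N s x x)) =
      \<psi> (step_moments U V N 1 x y) - \<psi> (step_moments U V N 1 x x)" if "s > 0" for s
  proof -
    \<comment> \<open>The homothety with this ratio multiplies volumes by \<open>s\<close>.\<close>
    define t where "t = root CARD('n) s"
    have t: "t > 0" "t ^ CARD('n) = s"
      using that by (simp_all add: t_def)
    let ?T = "affine_density (mat t) 0 :: 'n rvfun \<Rightarrow> 'n rvfun"
    have "det (mat t :: real^'n^'n) \<noteq> 0"
      using t(1) by (subst det_diagonal) (auto simp: mat_def)
    then have "invertible (mat t :: real^'n^'n)" by (simp add: invertible_det_nz)
    then obtain h where h: "h > 0" and h_inv: "\<forall>p\<in>prob_part F. \<forall>q\<in>prob_part F.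
        h * divergence (formula_score U V \<psi>) (?T p) (?T q) = divergence S p q"
      using assms(16) unfolding affine_invariant_divergence_def by metis
    have "h * (\<psi> (step_moments U V N s x y) - \<psi> (step_moments U V N s x x)) =
        \<psi> (step_moments U V N 1 x y) - \<psi> (step_moments U V N 1 x x)"
      if N: "N > 0" and x: "\<forall>j<N. 0 < x j" "sum x {..<N} = real N"
        and y: "\<forall>j<N. 0 < y j" "sum y {..<N} = real N" for N x y
    proof -
      have prob: "?f N u \<in> prob_part F" if "\<forall>j<N. 0 < u j" "sum u {..<N} = real N" for u
        using inF[of N u] step_density_integral[OF N, of ?k u] N that
        by (simp add: prob_part_def has_bochner_integral_iff)
      have "moments U V (?T (?f N x)) (?T (?f N u)) = step_moments U V N s x u" for u
        using moments_dilated_step_density[OF N t(1), of V U ?k x u] assms(12) by (simp add: t(2))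
      moreover have "S (?f N x) (?f N y) = \<psi> (step_moments U V N 1 x y)"
        "S (?f N x) (?f N x) = \<psi> (step_moments U V N 1 x x)"
        using N x(1) y(1) by (auto intro: score)
      ultimately show ?thesis
        using h_inv[rule_format, OF prob[OF x] prob[OF y]]
        by (simp add: divergence_def formula_score_def)
    qed
    then show ?thesis using h by blast
  qed
  obtain \<kappa> where \<kappa>: "\<kappa> \<noteq> 0" and dV: "\<And>z. z > 0 \<Longrightarrow> deriv V z = \<kappa> * (z * deriv U z)"
    using proper_imp_derivs_proportional[OF assms(7,9,8,10) proper reg] by blast
  obtain L where L: "(deriv V \<longlongrightarrow> L) (at_right 0)" using assms(13) by blast
  obtain a \<beta> where a: "a \<noteq> 0" and dU: "\<And>z. z > 0 \<Longrightarrow> deriv U z = a * z powr \<beta>"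
  proof (cases "\<exists>z3>0. \<exists>z4>0. z3 * deriv U z3 \<noteq> z4 * deriv U z4")
    case True
    then obtain z3 z4 where z34: "z3 > 0" "z4 > 0" "z3 * deriv U z3 \<noteq> z4 * deriv U z4" by blast
    have "\<forall>\<^sub>F s in nhds 1. deriv U z1 * deriv U (s * z2) = deriv U z2 * deriv U (s * z1)"
      if "z1 > 0" "z2 > 0" for z1 z2
      by (rule invariance_imp_ratio[OF assms(7,8) dV \<kappa> proper reg inv that z34])
    then show ?thesis
      using constant_ratio_imp_power[OF assms(7,9)] that by blast
  next
    case False
    obtain z0 where z0: "z0 > 0" "deriv U z0 \<noteq> 0"
      using nonconstant_deriv[OF assms(7,9)] .
    \<comment> \<open>Here \<open>z U' z\<close> is constant, so the dilation argument has no direction with nonzero first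
      variation; but the derivative is known.\<close>
    have "deriv U z = z0 * deriv U z0 * z powr (-1)" if "z > 0" for z
    proof -
      have "z * deriv U z = z0 * deriv U z0" using False that z0(1) by blast
      then show ?thesis using that by (simp add: powr_minus field_simps)
    qed
    then show ?thesis using that[of "z0 * deriv U z0" "-1"] z0 by (metis less_irrefl mult_eq_0_iff)
  qed
  show ?thesis
    by (rule integrate_power_solution[OF assms(7,8) a dU \<kappa> dV assms(11) L])
qed

end
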